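(* For all integers $m,k,p\ge 0$, \begin{align*} &(-1)^{k+p}(m+1)!(k+1)!\sum_{i=0}^{m}\frac{(\ln 2)^i}{i!}\zeta(\bar 1,\{1\}_{m-i},2,\{1\}_p,2,\{1\}_k)\\ &+(-1)^{m+1}(k+1)!(m+1)!\sum_{i=0}^{k}\frac{(\ln 2)^i}{i!}\zeta(\bar 1,\{1\}_{k-i},2,\{1\}_p,2,\{1\}_m)\\ &+(-1)^{k+p}(k+1)!(\ln 2)^{m+1}\zeta(\bar 2,\{1\}_p,2,\{1\}_k)+(-1)^{m+1}(m+1)!(\ln 2)^{k+1}\zeta(\bar 2,\{1\}_p,2,\{1\}_m)\\ &=(-1)^{m+k+p+1}(m+1)!(k+1)!\,\zeta(\bar 2,\{1\}_m)\,\zeta(\bar 1,\{1\}_p,2,\{1\}_k)\\ &\quad+(-1)^{m+k}(k+1)!(m+1)!\,\zeta(\bar 2,\{1\}_k)\,\zeta(\bar 1,\{1\}_p,2,\{1\}_m)\\ &\quad+(-1)^{m+k+p+1}(k+1)!(m+1)!\sum_{i=1}^{p}(-1)^i\zeta(\bar 1,\{1\}_{i-1},2,\{1\}_m)\,\zeta(\bar 1,\{1\}_{p-i},2,\{1\}_k). \end{align*}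
   Context: For nonzero integers $s_1,\dots,s_k$, with $\operatorname{sgn}(s)=1$ if $s>0$ and $-1$ if $s<0$, the multiple zeta value is $\zeta(s_1,\dots,s_k)=\sum_{n_1>n_2>\cdots>n_k\ge 1}\prod_{j=1}^k n_j^{-|s_j|}\operatorname{sgn}(s_j)^{n_j}$. A barred entry $\bar q$ denotes the negative entry $-q$. The notation $\{1\}_d$ means the entry $1$ repeated $d$ times ($d=0$ means no entries). An empty sum is $0$. *)

theory Defs
  imports Complex_Main
begin

text \<open>Truncated multiple zeta sum: sum over N \<ge> n_1 > n_2 > ... > n_k \<ge> 1 of
  prod_j sgn(s_j)^(n_j) / n_j^|s_j|.\<close>
fun mzv_trunc :: "int list \<Rightarrow> nat \<Rightarrow> real" where
  "mzv_trunc [] N = 1"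
| "mzv_trunc (s # ss) N =
     (\<Sum>n\<in>{1..N}. (of_int (sgn s)) ^ n / (real n) ^ (nat \<bar>s\<bar>) * mzv_trunc ss (n - 1))"

definition mzv :: "int list \<Rightarrow> real" where
  "mzv s = lim (\<lambda>N. mzv_trunc s N)"

abbreviation ones :: "nat \<Rightarrow> int list" where
  "ones d \<equiv> replicate d 1"

end

theory Submission
  imports
    Defs
    "HOL-Computational_Algebra.Formal_Power_Series"
    "HOL-Analysis.Harmonic_Numbers"
    "HOL-Real_Asymp.Real_Asymp"
begin

text \<open>
  Write \<open>Li(s\<^sub>1, \<dots>, s\<^sub>k; x)\<close> for the multiple polylogarithm, \<open>L = Li(1; x)\<close>,
  \<open>P\<^sub>m\<^sub>,\<^sub>j = Li({1}\<^sub>j, 2, {1}\<^sub>m; x)\<close> and \<open>b = 1 / (1 - x)\<close>. Then \<open>P\<^sub>m\<^sub>,\<^sub>j\<^sub>+\<^sub>1' = b P\<^sub>m\<^sub>,\<^sub>j\<close> and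
  \<open>x P\<^sub>m\<^sub>,\<^sub>0' = L^(m+1) / (m+1)!\<close>. Since \<open>L = - ln 2\<close> at \<open>x = -1\<close>, each sum on the left-hand side,
  together with the matching \<open>\<zeta>\<close>-value with leading entry \<open>-2\<close>, is the value at \<open>-1\<close> of
  \<open>\<Sum>i\<le>m+1. (-1)^i L^i / i! Li({1}\<^sub>m\<^sub>+\<^sub>1\<^sub>-\<^sub>i, 2, {1}\<^sub>p, 2, {1}\<^sub>k; x)\<close>,
  whose derivative is \<open>(-1)^(m+1) P\<^sub>m\<^sub>,\<^sub>0' P\<^sub>k\<^sub>,\<^sub>p\<^sub>+\<^sub>1\<close>. Repeated integration by parts turns
  the combination of \<open>P\<^sub>m\<^sub>,\<^sub>0' P\<^sub>k\<^sub>,\<^sub>p\<^sub>+\<^sub>1\<close> and \<open>P\<^sub>k\<^sub>,\<^sub>0' P\<^sub>m\<^sub>,\<^sub>p\<^sub>+\<^sub>1\<close> into the products on the right-hand side.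
\<close>

section \<open>Multiple polylogarithms as formal power series\<close>

text \<open>The coefficient at \<open>n\<close> collects the terms whose largest index is
  \<open>n\<close>. The sign of the leading entry is ignored, because evaluation at -1 supplies
  it.\<close>

definition polylog_fps :: "int list \<Rightarrow> real fps" where
  "polylog_fps r = (case r of [] \<Rightarrow> 1
     | s # t \<Rightarrow> Abs_fps (\<lambda>n. if n = 0 then 0 else mzv_trunc t (n - 1) / real n ^ nat \<bar>s\<bar>))"

lemma polylog_fps_Nil [simp]: "polylog_fps [] = 1"
  by (simp add: polylog_fps_def)

lemma polylog_fps_Cons_nth:
  "fps_nth (polylog_fps (s # t)) n = (if n = 0 then 0 else mzv_trunc t (n - 1) / real n ^ nat \<bar>s\<bar>)"
  by (simp add: polylog_fps_def)

lemma polylog_fps_nth_0: "r \<noteq> [] \<Longrightarrow> fps_nth (polylog_fps r) 0 = 0"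
  by (cases r) (simp_all add: polylog_fps_Cons_nth)

lemma mzv_trunc_diff:
  assumes "\<forall>s\<in>set r. s > 0"
  shows "mzv_trunc r (Suc n) - mzv_trunc r n = fps_nth (polylog_fps r) (Suc n)"
  using assms by (cases r) (simp_all add: polylog_fps_Cons_nth)

text \<open>The coefficients of the derivative are the truncated sums of \<open>r\<close>;
  multiplication by \<open>1 - fps_X\<close> takes their consecutive differences.\<close>

lemma fps_deriv_polylog_Cons_1:
  assumes "\<forall>s\<in>set r. s > 0"
  shows "(1 - fps_X) * fps_deriv (polylog_fps (1 # r)) = polylog_fps r"
proof (rule fps_ext)
  fix n
  have d: "fps_nth (fps_deriv (polylog_fps (1 # r))) j = mzv_trunc r j" for j
    by (simp add: polylog_fps_Cons_nth)
  show "fps_nth ((1 - fps_X) * fps_deriv (polylog_fps (1 # r))) n = fps_nth (polylog_fps r) n"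
  proof (cases n)
    case 0
    then show ?thesis
      by (cases r) (simp_all add: polylog_fps_Cons_nth)
  next
    case (Suc j)
    have "fps_nth ((1 - fps_X) * fps_deriv (polylog_fps (1 # r))) n
        = fps_nth (fps_deriv (polylog_fps (1 # r))) (Suc j) - fps_nth (fps_deriv (polylog_fps (1 # r))) j"
      using Suc by (simp add: left_diff_distrib del: fps_deriv_nth)
    also have "\<dots> = fps_nth (polylog_fps r) n"
      using mzv_trunc_diff[OF assms, of j] Suc by (simp only: d)
    finally show ?thesis .
  qed
qed

lemma fps_deriv_polylog_Cons_Suc:
  assumes "s > 0"
  shows "fps_X * fps_deriv (polylog_fps ((s + 1) # r)) = polylog_fps (s # r)"
proof (rule fps_ext)
  fix n
  have "nat (s + 1) = Suc (nat s)"
    using assms by simp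
  then show "fps_nth (fps_X * fps_deriv (polylog_fps ((s + 1) # r))) n = fps_nth (polylog_fps (s # r)) n"
    using assms by (cases n) (auto simp: polylog_fps_Cons_nth simp del: of_nat_Suc)
qed

lemma fps_eqI_deriv:
  fixes f g :: "real fps"
  assumes "fps_deriv f = fps_deriv g" "fps_nth f 0 = fps_nth g 0"
  shows "f = g"
  using assms by (simp add: fps_deriv_eq_iff)

definition geom_fps :: "real fps" where
  "geom_fps = inverse (1 - fps_X)"

lemma geom_fps_mult: "geom_fps * (1 - fps_X) = 1"
  unfolding geom_fps_def by (rule inverse_mult_eq_1) simp

lemma fps_deriv_polylog_1:
  assumes "\<forall>s\<in>set r. s > 0"
  shows "fps_deriv (polylog_fps (1 # r)) = geom_fps * polylog_fps r"
  unfolding fps_deriv_polylog_Cons_1[OF assms, symmetric] mult.assoc[symmetric] geom_fps_mult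
  by simp

text \<open>Induction on \<open>n\<close>: both sides have the same constant term and the same
  derivative, since \<open>polylog_fps [1]\<close> has derivative \<open>geom_fps\<close>.\<close>

lemma polylog_fps_ones:
  "polylog_fps (ones n) = fps_const (1 / fact n) * polylog_fps [1] ^ n"
proof (induction n)
  case (Suc n)
  show ?case
  proof (rule fps_eqI_deriv)
    have "fps_deriv (polylog_fps (ones (Suc n))) = geom_fps * (fps_const (1 / fact n) * polylog_fps [1] ^ n)"
      using fps_deriv_polylog_1[of "ones n"] Suc by simp
    also have "fps_const (1 / fact n :: real) = fps_const (1 / fact (Suc n)) * fps_const (real (Suc n))"
      by (simp add: divide_simps)
    also have "geom_fps * (fps_const (1 / fact (Suc n)) * fps_const (real (Suc n)) * polylog_fps [1] ^ n)
        = fps_deriv (fps_const (1 / fact (Suc n)) * polylog_fps [1] ^ Suc n)"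
      using fps_deriv_polylog_1[of "[]"]
      by (simp only: fps_deriv_power fps_deriv_mult_const_left) (simp add: mult_ac del: of_nat_Suc fact_Suc)
    finally show "fps_deriv (polylog_fps (ones (Suc n)))
        = fps_deriv (fps_const (1 / fact (Suc n)) * polylog_fps [1] ^ Suc n)" .
  qed (simp add: polylog_fps_nth_0)
qed simp

section \<open>Derivatives of alternating sums of products\<close>

lemma fps_deriv_minus_one_power [simp]: "fps_deriv ((-1) ^ i) = (0 :: real fps)"
  by (cases "even i") simp_all

text \<open>The series \<open>P\<^sub>m\<^sub>,\<^sub>j\<close>: the first argument counts the
  trailing ones, the second the leading ones. Height one means that a single entry exceeds
  1.\<close>

definition height_one_fps :: "nat \<Rightarrow> nat \<Rightarrow> real fps" where
  "height_one_fps m j = polylog_fps (ones j @ [2] @ ones m)"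

lemma fps_deriv_ones_append_2:
  assumes "\<forall>s\<in>set r. s > 0"
  shows "fps_deriv (polylog_fps (ones (Suc j) @ [2] @ r)) = geom_fps * polylog_fps (ones j @ [2] @ r)"
proof -
  have "\<forall>s\<in>set (ones j @ [2] @ r). s > 0"
    using assms by (auto dest: in_set_replicate[THEN iffD1])
  then show ?thesis
    using fps_deriv_polylog_1 by simp
qed

lemma fps_deriv_height_one_fps_Suc: "fps_deriv (height_one_fps m (Suc j)) = geom_fps * height_one_fps m j"
  unfolding height_one_fps_def by (rule fps_deriv_ones_append_2) auto

lemma fps_deriv_height_one_fps_0: "fps_X * fps_deriv (height_one_fps m 0) = polylog_fps (ones (Suc m))"
  using fps_deriv_polylog_Cons_Suc[of 1 "ones m"] by (simp add: height_one_fps_def)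

text \<open>By \<open>polylog_fps_ones\<close> the middle factor is \<open>L^i / i!\<close>. At -1,
  where \<open>L = - ln 2\<close>, the alternating signs cancel.\<close>

definition shuffle_fps :: "int list \<Rightarrow> nat \<Rightarrow> real fps" where
  "shuffle_fps r n = (\<Sum>i\<le>n. (-1) ^ i * polylog_fps (ones i) * polylog_fps (ones (n - i) @ [2] @ r))"

text \<open>The terms from the entries 1 telescope; only the derivative at the leading 2 survives.\<close>
lemma fps_deriv_shuffle_fps:
  assumes r: "\<forall>s\<in>set r. s > 0"
  shows "fps_deriv (shuffle_fps r n) = (-1) ^ n * polylog_fps (ones n) * fps_deriv (polylog_fps (2 # r))"
proof (cases n)
  case 0
  then show ?thesis by (simp add: shuffle_fps_def)
next
  case (Suc l)
  let ?E = "\<lambda>i. polylog_fps (ones i)"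
  let ?Q = "\<lambda>i. polylog_fps (ones i @ [2] @ r)"
  have E: "fps_deriv (?E (Suc i)) = geom_fps * ?E i" for i
    using fps_deriv_polylog_1[of "ones i"] by simp
  have Q: "fps_deriv (?Q (Suc i)) = geom_fps * ?Q i" for i
    using r by (rule fps_deriv_ones_append_2)
  have "fps_deriv (shuffle_fps r n)
      = (\<Sum>i\<le>Suc l. (-1) ^ i * fps_deriv (?E i) * ?Q (Suc l - i))
      + (\<Sum>i\<le>Suc l. (-1) ^ i * ?E i * fps_deriv (?Q (Suc l - i)))"
    unfolding shuffle_fps_def Suc fps_deriv_sum sum.distrib[symmetric]
    by (intro sum.cong) (simp_all add: algebra_simps)
  \<comment> \<open>The term \<open>i = 0\<close> vanishes because \<open>?E 0\<close> is constant;
    the index shift then flips the sign.\<close>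
  also have "(\<Sum>i\<le>Suc l. (-1) ^ i * fps_deriv (?E i) * ?Q (Suc l - i))
      = - (\<Sum>i\<le>l. (-1) ^ i * geom_fps * ?E i * ?Q (l - i))"
    unfolding sum.atMost_Suc_shift[of _ l] sum_negf[symmetric] E by (simp add: algebra_simps)
  \<comment> \<open>Only in the last term, \<open>i = Suc l\<close>, is no leading one left to
    remove, so it is split off.\<close>
  also have "(\<Sum>i\<le>Suc l. (-1) ^ i * ?E i * fps_deriv (?Q (Suc l - i)))
      = (\<Sum>i\<le>l. (-1) ^ i * geom_fps * ?E i * ?Q (l - i))
        + (-1) ^ n * ?E n * fps_deriv (polylog_fps (2 # r))"
  proof -
    have "(-1) ^ i * ?E i * fps_deriv (?Q (Suc l - i)) = (-1) ^ i * geom_fps * ?E i * ?Q (l - i)"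
      if "i \<in> {..l}" for i
      using that Q[of "l - i"] by (simp add: Suc_diff_le algebra_simps del: replicate.simps)
    then have "(\<Sum>i\<le>l. (-1) ^ i * ?E i * fps_deriv (?Q (Suc l - i)))
        = (\<Sum>i\<le>l. (-1) ^ i * geom_fps * ?E i * ?Q (l - i))"
      by (rule sum.cong [OF refl])
    then show ?thesis
      by (simp add: Suc)
  qed
  finally show ?thesis by simp
qed

text \<open>Both \<open>fps_deriv (height_one_fps m 0)\<close> and the derivative at a leading 2
  contain a factor 1/x. Multiplying by \<open>fps_X\<close> lets this factor pass from one to the
  other; then \<open>fps_X\<close> is cancelled.\<close>

lemma fps_deriv_shuffle_fps_height_one:
  "fps_deriv (shuffle_fps (ones p @ [2] @ ones k) (Suc m))
    = (-1) ^ Suc m * fps_deriv (height_one_fps m 0) * height_one_fps k (Suc p)"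
proof -
  let ?r = "ones p @ [2] @ ones k"
  have "fps_X * (polylog_fps (ones (Suc m)) * fps_deriv (polylog_fps (2 # ?r)))
      = fps_X * (fps_deriv (height_one_fps m 0) * polylog_fps (1 # ?r))"
    unfolding fps_deriv_height_one_fps_0[symmetric] using fps_deriv_polylog_Cons_Suc[of 1 ?r]
    by (simp add: mult_ac)
  then have "polylog_fps (ones (Suc m)) * fps_deriv (polylog_fps (2 # ?r))
      = fps_deriv (height_one_fps m 0) * height_one_fps k (Suc p)"
    by (simp add: height_one_fps_def)
  moreover have "\<forall>s\<in>set ?r. s > 0"
    by (auto dest: in_set_replicate[THEN iffD1])
  ultimately show ?thesis
    by (subst fps_deriv_shuffle_fps) (simp_all only: mult.assoc)
qed

text \<open>By the product rule each summand becomes \<open>geom_fps\<close> times a difference of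
  consecutive terms of one sequence, so the sum telescopes to its two ends.\<close>

lemma fps_deriv_sum_height_one_fps:
  "fps_deriv (\<Sum>i=1..p. (-1) ^ i * height_one_fps m i * height_one_fps k (Suc (p - i)))
    = geom_fps * ((-1) ^ p * height_one_fps m p * height_one_fps k 0 - height_one_fps m 0 * height_one_fps k p)"
proof -
  let ?u = "\<lambda>i. (-1) ^ i * height_one_fps m i * height_one_fps k (p - i)"
  have "fps_deriv (\<Sum>i=1..p. (-1) ^ i * height_one_fps m i * height_one_fps k (Suc (p - i)))
      = (\<Sum>i=1..p. geom_fps * (?u i - ?u (i - 1)))"
    unfolding fps_deriv_sum
  proof (rule sum.cong [OF refl])
    fix i assume "i \<in> {1..p}"
    then obtain j where j: "i = Suc j" "Suc (p - i) = p - j"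
      by (cases i) auto
    show "fps_deriv ((-1) ^ i * height_one_fps m i * height_one_fps k (Suc (p - i))) = geom_fps * (?u i - ?u (i - 1))"
      using fps_deriv_height_one_fps_Suc[of k "p - i"] fps_deriv_height_one_fps_Suc[of m j]
      by (simp add: j algebra_simps) (simp add: j(2)[symmetric] j(1) algebra_simps)
  qed
  also have "\<dots> = geom_fps * (\<Sum>i=Suc 0..p. ?u i - ?u (i - 1))"
    by (simp add: sum_distrib_left)
  also have "(\<Sum>i=Suc 0..p. ?u i - ?u (i - 1)) = ?u p - ?u 0"
    by (rule sum_telescope'') simp
  finally show ?thesis by simp
qed

lemma shuffle_fps_nth_0: "fps_nth (shuffle_fps r n) 0 = 0"
  unfolding shuffle_fps_def fps_sum_nth
  by (rule sum.neutral) (simp add: polylog_fps_nth_0)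

text \<open>All constant terms are 0, so derivatives are compared. The product rule on the first two
  terms of the right side gives the derivative of the left side plus multiples of
  \<open>geom_fps\<close>, which cancel against the ends of the telescoped sum.\<close>

lemma shuffle_fps_identity:
  "(-1) ^ (k + p) * shuffle_fps (ones p @ [2] @ ones k) (Suc m)
    + (-1) ^ (m + 1) * shuffle_fps (ones p @ [2] @ ones m) (Suc k)
  = (-1) ^ (m + k + p + 1) * (height_one_fps m 0 * height_one_fps k (Suc p))
    + (-1) ^ (m + k) * (height_one_fps k 0 * height_one_fps m (Suc p))
    + (-1) ^ (m + k + p + 1) * (\<Sum>i=1..p. (-1) ^ i * height_one_fps m i * height_one_fps k (Suc (p - i)))"
  (is "?L = ?R")
proof (rule fps_eqI_deriv)
  \<comment> \<open>One end of the telescoped sum carries \<open>(-1) ^ p\<close>, which meets the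
    same sign outside the sum.\<close>
  have "(-1) ^ p * (-1) ^ p = (1 :: real fps)"
    by (simp flip: power_mult_distrib)
  then have pp: "(-1) ^ p * ((-1) ^ p * f) = f" for f :: "real fps"
    by (simp flip: mult.assoc)
  show "fps_deriv ?L = fps_deriv ?R"
    by (simp only: fps_deriv_add fps_deriv_mult fps_deriv_minus_one_power fps_deriv_shuffle_fps_height_one
        fps_deriv_sum_height_one_fps fps_deriv_height_one_fps_Suc)
      (simp add: power_add algebra_simps pp)
  have "fps_nth (height_one_fps i j) 0 = 0" for i j
    by (simp add: height_one_fps_def polylog_fps_nth_0)
  then show "fps_nth ?L 0 = fps_nth ?R 0"
    by (simp add: shuffle_fps_nth_0 fps_sum_nth)
qed

section \<open>Evaluation at \<open>-1\<close>\<close>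

text \<open>Absolute convergence is included so that Cauchy products can be formed.\<close>

definition abs_sums_m1 :: "real fps \<Rightarrow> real \<Rightarrow> bool" where
  "abs_sums_m1 f v \<longleftrightarrow> summable (\<lambda>n. \<bar>fps_nth f n\<bar>) \<and> (\<lambda>n. fps_nth f n * (-1) ^ n) sums v"

lemma abs_sums_m1_unique: "abs_sums_m1 f v \<Longrightarrow> abs_sums_m1 f w \<Longrightarrow> v = w"
  unfolding abs_sums_m1_def by (blast intro: sums_unique2)

lemma abs_sums_m1_add:
  assumes "abs_sums_m1 f v" "abs_sums_m1 g w"
  shows "abs_sums_m1 (f + g) (v + w)"
proof -
  have "summable (\<lambda>n. \<bar>fps_nth f n\<bar> + \<bar>fps_nth g n\<bar>)"
    using assms by (intro summable_add) (auto simp: abs_sums_m1_def)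
  then have "summable (\<lambda>n. \<bar>fps_nth (f + g) n\<bar>)"
    by (rule summable_comparison_test') (simp add: abs_triangle_ineq)
  moreover have "(\<lambda>n. fps_nth (f + g) n * (-1) ^ n) sums (v + w)"
    using assms by (simp add: abs_sums_m1_def distrib_right sums_add)
  ultimately show ?thesis by (simp add: abs_sums_m1_def)
qed

lemma abs_sums_m1_mult:
  assumes "abs_sums_m1 f v" "abs_sums_m1 g w"
  shows "abs_sums_m1 (f * g) (v * w)"
proof -
  let ?a = "\<lambda>n. fps_nth f n * (-1) ^ n" and ?b = "\<lambda>n. fps_nth g n * (-1) ^ n"
  have f: "summable (\<lambda>n. \<bar>fps_nth f n\<bar>)" "?a sums v" and g: "summable (\<lambda>n. \<bar>fps_nth g n\<bar>)" "?b sums w"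
    using assms by (auto simp: abs_sums_m1_def)
  have "summable (\<lambda>n. \<Sum>i\<le>n. \<bar>fps_nth f i\<bar> * \<bar>fps_nth g (n - i)\<bar>)"
    using f(1) g(1) by (intro summable_Cauchy_product) simp_all
  then have "summable (\<lambda>n. \<bar>fps_nth (f * g) n\<bar>)"
  proof (rule summable_comparison_test')
    fix n show "norm \<bar>fps_nth (f * g) n\<bar> \<le> (\<Sum>i\<le>n. \<bar>fps_nth f i\<bar> * \<bar>fps_nth g (n - i)\<bar>)"
      using sum_abs[of "\<lambda>i. fps_nth f i * fps_nth g (n - i)" "{..n}"]
      by (simp add: fps_mult_nth atLeast0AtMost abs_mult)
  qed
  moreover have "(\<lambda>k. \<Sum>i\<le>k. ?a i * ?b (k - i)) sums (suminf ?a * suminf ?b)"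
    using f(1) g(1) by (intro Cauchy_product_sums) (simp_all add: abs_mult)
  moreover have "(\<Sum>i\<le>k. ?a i * ?b (k - i)) = fps_nth (f * g) k * (-1) ^ k" for k
    unfolding fps_mult_nth sum_distrib_right atLeast0AtMost
  proof (rule sum.cong [OF refl])
    fix i assume "i \<in> {..k}"
    then have "(-1) ^ k = (-1) ^ i * (-1 :: real) ^ (k - i)"
      by (simp flip: power_add)
    then show "?a i * ?b (k - i) = fps_nth f i * fps_nth g (k - i) * (-1) ^ k" by simp
  qed
  ultimately show ?thesis
    using f(2) g(2) by (simp add: abs_sums_m1_def sums_unique[symmetric])
qed

lemma abs_sums_m1_const: "abs_sums_m1 (fps_const c) c"
proof -
  have "(\<lambda>n. fps_nth (fps_const c) n * (-1) ^ n) sums (\<Sum>n\<in>{0}. fps_nth (fps_const c) n * (-1) ^ n)"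
    by (rule sums_finite) auto
  moreover have "summable (\<lambda>n. \<bar>fps_nth (fps_const c) n\<bar>)"
    by (rule summable_finite[of "{0}"]) auto
  ultimately show ?thesis by (simp add: abs_sums_m1_def)
qed

lemma abs_sums_m1_one_minus_X: "abs_sums_m1 (1 - fps_X) 2"
proof -
  have "(\<lambda>n. fps_nth (1 - fps_X :: real fps) n * (-1) ^ n) sums (\<Sum>n\<in>{0, 1}. fps_nth (1 - fps_X) n * (-1) ^ n)"
    by (rule sums_finite) auto
  moreover have "summable (\<lambda>n. \<bar>fps_nth (1 - fps_X :: real fps) n\<bar>)"
    by (rule summable_finite[of "{0, 1}"]) auto
  ultimately show ?thesis by (simp add: abs_sums_m1_def)
qed

text \<open>Multiplication by a power of \<open>1 - X\<close> turns the conditionally convergent series at \<open>-1\<close>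
  into absolutely convergent ones; since \<open>1 - X\<close> has the value \<open>2 \<noteq> 0\<close> there, the value
  can be recovered. This makes evaluation at \<open>-1\<close> multiplicative without Abel's limit theorem.\<close>
definition has_value_m1 :: "real fps \<Rightarrow> real \<Rightarrow> bool" where
  "has_value_m1 f v \<longleftrightarrow> (\<exists>j. abs_sums_m1 ((1 - fps_X) ^ j * f) (2 ^ j * v))"

lemma abs_sums_m1_one_minus_X_power:
  "abs_sums_m1 f v \<Longrightarrow> abs_sums_m1 ((1 - fps_X) ^ j * f) (2 ^ j * v)"
  by (induction j) (simp_all add: abs_sums_m1_mult[OF abs_sums_m1_one_minus_X] mult.assoc)

lemma abs_sums_m1_imp_has_value_m1: "abs_sums_m1 f v \<Longrightarrow> has_value_m1 f v"
  unfolding has_value_m1_def by (intro exI[of _ 0]) simp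

text \<open>Every further factor \<open>1 - fps_X\<close> preserves absolute convergence and doubles
  the value, so two series can be given a common exponent.\<close>

lemma has_value_m1_eventually:
  assumes "has_value_m1 f v"
  obtains j where "\<And>i. i \<ge> j \<Longrightarrow> abs_sums_m1 ((1 - fps_X) ^ i * f) (2 ^ i * v)"
proof -
  obtain j where j: "abs_sums_m1 ((1 - fps_X) ^ j * f) (2 ^ j * v)"
    using assms by (auto simp: has_value_m1_def)
  have "abs_sums_m1 ((1 - fps_X) ^ i * f) (2 ^ i * v)" if "i \<ge> j" for i
    using abs_sums_m1_one_minus_X_power[OF j, of "i - j"] that
    by (simp flip: mult.assoc power_add)
  then show ?thesis using that by blast
qed

lemma has_value_m1_unique:
  assumes "has_value_m1 f v" "has_value_m1 f w"
  shows "v = w"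
proof -
  obtain j1 where j1: "\<And>i. i \<ge> j1 \<Longrightarrow> abs_sums_m1 ((1 - fps_X) ^ i * f) (2 ^ i * v)"
    using has_value_m1_eventually assms(1) by blast
  obtain j2 where j2: "\<And>i. i \<ge> j2 \<Longrightarrow> abs_sums_m1 ((1 - fps_X) ^ i * f) (2 ^ i * w)"
    using has_value_m1_eventually assms(2) by blast
  have "2 ^ max j1 j2 * v = 2 ^ max j1 j2 * w"
    by (rule abs_sums_m1_unique[OF j1 j2]) auto
  then show ?thesis by simp
qed

lemma has_value_m1_add:
  assumes "has_value_m1 f v" "has_value_m1 g w"
  shows "has_value_m1 (f + g) (v + w)"
proof -
  obtain j1 where j1: "\<And>i. i \<ge> j1 \<Longrightarrow> abs_sums_m1 ((1 - fps_X) ^ i * f) (2 ^ i * v)"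
    using has_value_m1_eventually assms(1) by blast
  obtain j2 where j2: "\<And>i. i \<ge> j2 \<Longrightarrow> abs_sums_m1 ((1 - fps_X) ^ i * g) (2 ^ i * w)"
    using has_value_m1_eventually assms(2) by blast
  show ?thesis
    using abs_sums_m1_add[OF j1 j2, of "max j1 j2" "max j1 j2"]
    unfolding has_value_m1_def by (intro exI[of _ "max j1 j2"]) (simp add: distrib_left)
qed

lemma has_value_m1_mult:
  assumes "has_value_m1 f v" "has_value_m1 g w"
  shows "has_value_m1 (f * g) (v * w)"
proof -
  obtain i j where "abs_sums_m1 ((1 - fps_X) ^ i * f) (2 ^ i * v)"
    and "abs_sums_m1 ((1 - fps_X) ^ j * g) (2 ^ j * w)"
    using assms by (auto simp: has_value_m1_def)
  from abs_sums_m1_mult[OF this] show ?thesis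
    unfolding has_value_m1_def by (intro exI[of _ "i + j"]) (simp add: power_add mult_ac)
qed

lemma has_value_m1_const: "has_value_m1 (fps_const c) c"
  by (intro abs_sums_m1_imp_has_value_m1 abs_sums_m1_const)

lemma has_value_m1_power: "has_value_m1 f v \<Longrightarrow> has_value_m1 (f ^ n) (v ^ n)"
  using has_value_m1_const[of 1] by (induction n) (simp_all add: has_value_m1_mult)

lemma has_value_m1_minus_one_power: "has_value_m1 ((-1) ^ n) ((-1) ^ n)"
  using has_value_m1_power[OF has_value_m1_const[of "-1"]] by (simp flip: fps_const_neg)

lemma has_value_m1_sum:
  assumes "\<And>i. i \<in> A \<Longrightarrow> has_value_m1 (f i) (v i)"
  shows "has_value_m1 (sum f A) (sum v A)"
  using assms
proof (induction A rule: infinite_finite_induct)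
  case (insert x A)
  then show ?case by (simp add: has_value_m1_add)
\<comment> \<open>A sum over an infinite set is 0 by convention, so this case and the empty one both
  ask for the value of the zero series.\<close>
qed (use has_value_m1_const[of 0] in simp_all)

section \<open>Multiple zeta values as values of polylogarithms\<close>

lemma mzv_trunc_nonneg:
  assumes "\<forall>s\<in>set r. s > 0"
  shows "mzv_trunc r N \<ge> 0"
  using assms by (induction r arbitrary: N) (auto intro!: sum_nonneg)

lemma mzv_trunc_mono:
  assumes "\<forall>s\<in>set r. s > 0" "M \<le> N"
  shows "mzv_trunc r M \<le> mzv_trunc r N"
  using assms by (cases r) (auto intro!: sum_mono2 divide_nonneg_nonneg mzv_trunc_nonneg)

text \<open>Replacing every exponent by 1 and every inner truncation by \<open>N\<close> decouples
  the nested sum into a product of harmonic numbers.\<close>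

lemma mzv_trunc_le_harm_power:
  assumes "\<forall>s\<in>set r. s > 0"
  shows "mzv_trunc r N \<le> harm N ^ length r"
  using assms
proof (induction r arbitrary: N)
  case (Cons s r)
  have "mzv_trunc (s # r) N = (\<Sum>n\<in>{1..N}. 1 / real n ^ nat s * mzv_trunc r (n - 1))"
    using Cons.prems by simp
  also have "\<dots> \<le> (\<Sum>n\<in>{1..N}. inverse (real n) * harm N ^ length r)"
  proof (intro sum_mono mult_mono)
    fix n assume n: "n \<in> {1..N}"
    have "real n ^ 1 \<le> real n ^ nat s"
      using n Cons.prems by (intro power_increasing) auto
    then show "1 / real n ^ nat s \<le> inverse (real n)"
      using n by (simp add: field_simps)
    have "mzv_trunc r (n - 1) \<le> mzv_trunc r N"
      using n Cons.prems by (intro mzv_trunc_mono) auto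
    also have "\<dots> \<le> harm N ^ length r"
      using Cons by simp
    finally show "mzv_trunc r (n - 1) \<le> harm N ^ length r" .
  qed (use Cons.prems in \<open>auto intro: mzv_trunc_nonneg\<close>)
  also have "\<dots> = harm N ^ length (s # r)"
    by (simp add: harm_def sum_distrib_right)
  finally show ?case .
qed simp

lemma mzv_trunc_le_ln_power:
  assumes "\<forall>s\<in>set r. s > 0"
  shows "mzv_trunc r N \<le> (1 + ln (1 + real N)) ^ length r"
proof -
  have "harm (Suc n) \<le> 1 + ln (1 + real n)" for n
  proof (induction n)
    case (Suc n)
    \<comment> \<open>The bound ln x \<le> x - 1 shows that the logarithm grows at least as much as
      the harmonic number in this step.\<close>
    have "ln ((1 + real n) / (2 + real n)) \<le> (1 + real n) / (2 + real n) - 1"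
      by (intro ln_le_minus_one) simp
    also have "\<dots> = - inverse (2 + real n)"
      by (simp add: field_simps)
    finally have "inverse (2 + real n) \<le> ln (2 + real n) - ln (1 + real n)"
      by (simp add: ln_div)
    then show ?case
      using Suc by (simp add: harm_Suc[of "Suc n"])
  qed (simp add: harm_def)
  \<comment> \<open>Passing from \<open>N\<close> to \<open>Suc N\<close> also covers
    \<open>N = 0\<close>.\<close>
  from order_trans[OF harm_mono this] have "harm N \<le> 1 + ln (1 + real N)"
    by simp
  then show ?thesis
    using mzv_trunc_le_harm_power[OF assms, of N] power_mono[OF _ harm_nonneg] order_trans by blast
qed

text \<open>The exponent -3/2 lies strictly between -2 and -1: still summable, with room to absorb
  any power of the logarithm.\<close>

lemma summable_ln_power_over_square:
  "summable (\<lambda>n. (1 + ln (1 + real n)) ^ d / (1 + real n) ^ 2)"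
proof (rule summable_comparison_test_bigo)
  show "summable (\<lambda>n. norm (real n powr (-3/2)))"
    by (simp add: summable_real_powr_iff)
  show "(\<lambda>n. (1 + ln (1 + real n)) ^ d / (1 + real n) ^ 2) \<in> O(\<lambda>n. real n powr (-3/2))"
    by real_asymp
qed

text \<open>Negating the leading entry inserts the factor \<open>(-1) ^ n\<close>, so truncated sums
  are exactly the partial sums of the series at -1.\<close>

lemma mzv_trunc_minus_Cons:
  assumes "s > 0"
  shows "mzv_trunc (- s # r) N = (\<Sum>n\<le>N. fps_nth (polylog_fps (s # r)) n * (-1) ^ n)"
proof -
  have "(\<Sum>n\<le>N. fps_nth (polylog_fps (s # r)) n * (-1) ^ n)
      = (\<Sum>n\<in>{1..N}. fps_nth (polylog_fps (s # r)) n * (-1) ^ n)"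
    by (rule sum.mono_neutral_right) (auto simp: polylog_fps_Cons_nth)
  then show ?thesis
    using assms by (auto simp: polylog_fps_Cons_nth intro!: sum.cong)
qed

text \<open>The coefficients are bounded by a power of a logarithm over n^2, so the series at -1
  converges absolutely as it stands.\<close>

lemma has_value_m1_polylog_ge_2:
  assumes s: "s \<ge> 2" and r: "\<forall>s\<in>set r. s > 0"
  shows "has_value_m1 (polylog_fps (s # r)) (mzv (- s # r))"
proof -
  let ?f = "polylog_fps (s # r)"
  have "norm \<bar>fps_nth ?f (Suc n)\<bar> \<le> (1 + ln (1 + real n)) ^ length r / (1 + real n) ^ 2" for n
  proof -
    have "(1 + real n) ^ 2 \<le> (1 + real n) ^ nat s"
      using s by (intro power_increasing) auto
    then have "mzv_trunc r n / (1 + real n) ^ nat s \<le> (1 + ln (1 + real n)) ^ length r / (1 + real n) ^ 2"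
      using mzv_trunc_le_ln_power[OF r] by (intro frac_le) (auto simp: mzv_trunc_nonneg r)
    then show ?thesis
      using s mzv_trunc_nonneg[OF r] by (simp add: polylog_fps_Cons_nth)
  qed
  then have "summable (\<lambda>n. \<bar>fps_nth ?f (Suc n)\<bar>)"
    by (intro summable_comparison_test'[OF summable_ln_power_over_square])
  then have 1: "summable (\<lambda>n. \<bar>fps_nth ?f n\<bar>)"
    by (subst (asm) summable_Suc_iff)
  have "summable (\<lambda>n. fps_nth ?f n * (-1) ^ n)"
    by (rule summable_rabs_cancel) (simp add: abs_mult 1)
  then have 2: "(\<lambda>n. fps_nth ?f n * (-1) ^ n) sums (\<Sum>n. fps_nth ?f n * (-1) ^ n)"
    by (rule summable_sums)
  have "mzv_trunc (- s # r) = (\<lambda>N. \<Sum>n\<le>N. fps_nth ?f n * (-1) ^ n)"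
    using s by (intro ext mzv_trunc_minus_Cons) simp
  with 2 have "mzv (- s # r) = (\<Sum>n. fps_nth ?f n * (-1) ^ n)"
    unfolding mzv_def sums_def_le by (intro limI) (simp only:)
  with 1 2 show ?thesis
    by (intro abs_sums_m1_imp_has_value_m1) (simp add: abs_sums_m1_def)
qed

text \<open>The coefficients are only bounded by a logarithmic power over n. One factor
  \<open>1 - fps_X\<close> replaces them by differences, which gain another 1/n; summation by parts
  then relates the new series to the truncated sums.\<close>

lemma has_value_m1_polylog_1:
  assumes r: "\<forall>s\<in>set r. s > 0"
  shows "has_value_m1 (polylog_fps (1 # r)) (mzv (- 1 # r))"
proof -
  let ?f = "polylog_fps (1 # r)"
  let ?g = "(1 - fps_X) * ?f"
  define d where "d = length r"
  let ?h = "\<lambda>n. (1 + ln (1 + real n)) ^ d"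
  have g: "fps_nth ?g (Suc n) = fps_nth ?f (Suc n) - fps_nth ?f n" for n
    by (simp add: left_diff_distrib)
  \<comment> \<open>Starting at index 2 keeps the special coefficient at 0 out of the
    difference.\<close>
  have "norm \<bar>fps_nth ?g (Suc (Suc n))\<bar> \<le> 2 * (?h n / (1 + real n) ^ 2)" for n
  proof -
    let ?B = "mzv_trunc r n" and ?t = "fps_nth (polylog_fps r) (Suc n)"
    have B: "0 \<le> ?B" "?B \<le> ?h n"
      using mzv_trunc_nonneg[OF r] mzv_trunc_le_ln_power[OF r] by (auto simp: d_def)
    have t: "0 \<le> ?t"
      using mzv_trunc_mono[OF r, of n "Suc n"] mzv_trunc_diff[OF r, of n] by simp
    have "?t \<le> ?h n / (1 + real n)"
    proof (cases r)
      case (Cons s u)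
      have "mzv_trunc u n \<le> (1 + ln (1 + real n)) ^ length u"
        using r Cons by (intro mzv_trunc_le_ln_power) simp
      also have "\<dots> \<le> ?h n"
        by (rule power_increasing) (simp_all add: d_def Cons)
      finally have "mzv_trunc u n \<le> ?h n" .
      moreover have "(1 + real n) ^ 1 \<le> (1 + real n) ^ nat s"
        using r Cons by (intro power_increasing) auto
      ultimately have "mzv_trunc u n / (1 + real n) ^ nat s \<le> ?h n / (1 + real n)"
        by (intro frac_le) auto
      then show ?thesis
        using r Cons by (simp add: polylog_fps_Cons_nth)
    qed simp
    then have t2: "?t / (2 + real n) \<le> ?h n / (1 + real n) / (1 + real n)"
      using t by (intro frac_le) auto
    have B2: "?B / (1 + real n) / (2 + real n) \<le> ?h n / (1 + real n) / (1 + real n)"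
      using B by (intro frac_le divide_nonneg_nonneg divide_right_mono) auto
    \<comment> \<open>The difference has two sources: the growth \<open>?t\<close> of the inner sum
      and the change of denominator.\<close>
    have "fps_nth ?g (Suc (Suc n)) = (?B + ?t) / (2 + real n) - ?B / (1 + real n)"
      using mzv_trunc_diff[OF r, of n] unfolding g by (simp add: polylog_fps_Cons_nth)
    also have "\<dots> = ?t / (2 + real n) - ?B / (1 + real n) / (2 + real n)"
    proof -
      have "?B / (1 + real n) = ?B / (2 + real n) + ?B / (1 + real n) / (2 + real n)"
        by (simp add: divide_simps) (simp add: algebra_simps)
      then show ?thesis unfolding add_divide_distrib by linarith
    qed
    finally have "\<bar>fps_nth ?g (Suc (Suc n))\<bar> \<le> ?t / (2 + real n) + ?B / (1 + real n) / (2 + real n)"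
      using t B by (simp add: abs_le_iff add_increasing add_increasing2)
    also have "\<dots> \<le> 2 * (?h n / (1 + real n) ^ 2)"
      using t2 B2 by (simp add: power2_eq_square)
    finally show ?thesis by simp
  qed
  then have "summable (\<lambda>n. \<bar>fps_nth ?g (Suc (Suc n))\<bar>)"
    by (intro summable_comparison_test'[OF summable_mult[OF summable_ln_power_over_square]])
  then have 1: "summable (\<lambda>n. \<bar>fps_nth ?g n\<bar>)"
    by (simp only: summable_Suc_iff[of "\<lambda>n. \<bar>fps_nth ?g n\<bar>"]
      summable_Suc_iff[of "\<lambda>n. \<bar>fps_nth ?g (Suc n)\<bar>"])
  have "summable (\<lambda>n. fps_nth ?g n * (-1) ^ n)"
    by (rule summable_rabs_cancel) (simp add: abs_mult 1)
  then obtain G where G: "(\<lambda>n. fps_nth ?g n * (-1) ^ n) sums G"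
    by (auto simp: summable_def)
  have "(\<lambda>n. fps_nth ?f (Suc n)) \<longlonglongrightarrow> 0"
  proof (rule tendsto_sandwich[where f = "\<lambda>_. 0" and h = "\<lambda>n. ?h n / (1 + real n)"])
    show "(\<lambda>n. ?h n / (1 + real n)) \<longlonglongrightarrow> 0"
      by real_asymp
    show "\<forall>\<^sub>F n in sequentially. fps_nth ?f (Suc n) \<le> ?h n / (1 + real n)"
      using mzv_trunc_le_ln_power[OF r]
      by (intro always_eventually) (simp add: polylog_fps_Cons_nth d_def divide_right_mono)
    show "\<forall>\<^sub>F n in sequentially. 0 \<le> fps_nth ?f (Suc n)"
      using mzv_trunc_nonneg[OF r] by (intro always_eventually) (simp add: polylog_fps_Cons_nth)
  qed simp
  then have "fps_nth ?f \<longlonglongrightarrow> 0"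
    by (simp only: filterlim_sequentially_Suc)
  then have "(\<lambda>N. fps_nth ?f N * (-1) ^ N) \<longlonglongrightarrow> 0"
    by (simp add: tendsto_rabs_zero_iff[symmetric, of "\<lambda>N. fps_nth ?f N * (-1) ^ N"] abs_mult
        tendsto_rabs_zero)
  \<comment> \<open>The summand with \<open>fps_nth ?f N\<close> is the boundary term of summation
    by parts; the divisor 2 is the value of \<open>1 - fps_X\<close> at -1.\<close>
  then have "(\<lambda>N. ((\<Sum>n\<le>N. fps_nth ?g n * (-1) ^ n) + fps_nth ?f N * (-1) ^ N) / 2) \<longlonglongrightarrow> (G + 0) / 2"
    using G unfolding sums_def_le by (intro tendsto_intros) auto
  moreover have "(\<lambda>N. ((\<Sum>n\<le>N. fps_nth ?g n * (-1) ^ n) + fps_nth ?f N * (-1) ^ N) / 2)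
      = mzv_trunc (- 1 # r)"
  proof
    fix N
    have "(\<Sum>n\<le>N. fps_nth ?g n * (-1) ^ n) + fps_nth ?f N * (-1) ^ N
        = 2 * (\<Sum>n\<le>N. fps_nth ?f n * (-1) ^ n)"
    proof (induction N)
      case 0
      then show ?case by (simp add: polylog_fps_Cons_nth)
    next
      case (Suc N)
      then show ?case unfolding sum.atMost_Suc g by (simp add: algebra_simps)
    qed
    then show "((\<Sum>n\<le>N. fps_nth ?g n * (-1) ^ n) + fps_nth ?f N * (-1) ^ N) / 2 = mzv_trunc (- 1 # r) N"
      using mzv_trunc_minus_Cons[of 1 r N] by (simp del: mzv_trunc.simps)
  qed
  ultimately have v: "mzv (- 1 # r) = G / 2"
    unfolding mzv_def by (intro limI) (simp only: add_0_right)
  have "abs_sums_m1 ((1 - fps_X) ^ 1 * ?f) (2 ^ 1 * mzv (- 1 # r))"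
    using 1 G unfolding v by (simp add: abs_sums_m1_def)
  then show ?thesis
    unfolding has_value_m1_def by blast
qed

section \<open>Values of the building blocks at -1\<close>

lemma mzv_minus_1: "mzv [-1] = - ln 2"
proof -
  have "mzv_trunc [-1] = (\<lambda>N. - (\<Sum>k<N. (-1) ^ k / real_of_nat (Suc k)))"
  proof
    show "mzv_trunc [-1] N = - (\<Sum>k<N. (-1) ^ k / real_of_nat (Suc k))" for N
      by (induction N) simp_all
  qed
  moreover have "(\<lambda>N. - (\<Sum>k<N. (-1) ^ k / real_of_nat (Suc k))) \<longlonglongrightarrow> - ln 2"
    using alternating_harmonic_series_sums unfolding sums_def by (rule tendsto_minus)
  ultimately show ?thesis
    unfolding mzv_def by (intro limI) (simp only:)
qed

lemma has_value_m1_polylog_ones: "has_value_m1 (polylog_fps (ones n)) ((- ln 2) ^ n / fact n)"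
  using has_value_m1_mult[OF has_value_m1_const[of "1 / fact n"]
      has_value_m1_power[OF has_value_m1_polylog_1[of "[]"]], of n]
  by (simp add: polylog_fps_ones[of n] mzv_minus_1)

lemma has_value_m1_height_one_fps_0: "has_value_m1 (height_one_fps m 0) (mzv ([-2] @ ones m))"
  using has_value_m1_polylog_ge_2[of 2 "ones m"] by (simp add: height_one_fps_def)

lemma has_value_m1_ones_append_2:
  assumes "\<forall>s\<in>set r. s > 0"
  shows "has_value_m1 (polylog_fps (ones (Suc j) @ [2] @ r)) (mzv ([-1] @ ones j @ [2] @ r))"
proof -
  have "\<forall>s\<in>set (ones j @ [2] @ r). s > 0"
    using assms by (auto dest: in_set_replicate[THEN iffD1])
  from has_value_m1_polylog_1[OF this] show ?thesis by simp
qed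

lemma has_value_m1_height_one_fps_Suc:
  "has_value_m1 (height_one_fps m (Suc j)) (mzv ([-1] @ ones j @ [2] @ ones m))"
  unfolding height_one_fps_def by (rule has_value_m1_ones_append_2) auto

text \<open>The terms with \<open>i \<le> m\<close> have a leading one, which turns into the entry
  -1; the term \<open>i = Suc m\<close> starts with 2 and yields the entry -2.\<close>

lemma has_value_m1_shuffle_fps:
  assumes r: "\<forall>s\<in>set r. s > 0"
  shows "has_value_m1 (shuffle_fps r (Suc m))
    ((\<Sum>i=0..m. ln 2 ^ i / fact i * mzv ([-1] @ ones (m - i) @ [2] @ r))
      + ln 2 ^ Suc m / fact (Suc m) * mzv ([-2] @ r))"
proof -
  have sgn: "(-1) ^ i * ((- ln 2) ^ i / fact i) = (ln 2 ^ i / fact i :: real)" for i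
    by (simp flip: power_mult_distrib)
  have summand: "has_value_m1 ((-1) ^ i * polylog_fps (ones i) * f) (ln 2 ^ i / fact i * v)"
    if "has_value_m1 f v" for i f v
    using has_value_m1_mult[OF has_value_m1_mult[OF has_value_m1_minus_one_power
        has_value_m1_polylog_ones] that, of i i]
    unfolding sgn .
  have "has_value_m1 (\<Sum>i\<le>m. (-1) ^ i * polylog_fps (ones i) * polylog_fps (ones (Suc m - i) @ [2] @ r))
      (\<Sum>i\<le>m. ln 2 ^ i / fact i * mzv ([-1] @ ones (m - i) @ [2] @ r))"
  proof (intro has_value_m1_sum summand)
    fix i assume "i \<in> {..m}"
    then have "Suc m - i = Suc (m - i)" by auto
    then show "has_value_m1 (polylog_fps (ones (Suc m - i) @ [2] @ r)) (mzv ([-1] @ ones (m - i) @ [2] @ r))"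
      using has_value_m1_ones_append_2[OF r] by metis
  qed
  moreover have "has_value_m1 ((-1) ^ Suc m * polylog_fps (ones (Suc m)) * polylog_fps (ones 0 @ [2] @ r))
      (ln 2 ^ Suc m / fact (Suc m) * mzv ([-2] @ r))"
    using has_value_m1_polylog_ge_2[OF _ r, of 2] by (intro summand) simp
  ultimately show ?thesis
    unfolding shuffle_fps_def atLeast0AtMost sum.atMost_Suc diff_self_eq_0 by (rule has_value_m1_add)
qed

section \<open>Comparison of values in the series identity\<close>

theorem theorem4p3:
  fixes m k p :: nat
  shows
   "(-1::real)^(k+p) * fact (m+1) * fact (k+1) *
      (\<Sum>i=0..m. ln 2 ^ i / fact i * mzv ([-1] @ ones (m-i) @ [2] @ ones p @ [2] @ ones k))
  + (-1::real)^(m+1) * fact (k+1) * fact (m+1) *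
      (\<Sum>i=0..k. ln 2 ^ i / fact i * mzv ([-1] @ ones (k-i) @ [2] @ ones p @ [2] @ ones m))
  + (-1::real)^(k+p) * fact (k+1) * ln 2 ^ (m+1) * mzv ([-2] @ ones p @ [2] @ ones k)
  + (-1::real)^(m+1) * fact (m+1) * ln 2 ^ (k+1) * mzv ([-2] @ ones p @ [2] @ ones m)
  = (-1::real)^(m+k+p+1) * fact (m+1) * fact (k+1) *
      mzv ([-2] @ ones m) * mzv ([-1] @ ones p @ [2] @ ones k)
  + (-1::real)^(m+k) * fact (k+1) * fact (m+1) *
      mzv ([-2] @ ones k) * mzv ([-1] @ ones p @ [2] @ ones m)
  + (-1::real)^(m+k+p+1) * fact (k+1) * fact (m+1) *
      (\<Sum>i=1..p. (-1)^i * mzv ([-1] @ ones (i-1) @ [2] @ ones m)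
                         * mzv ([-1] @ ones (p-i) @ [2] @ ones k))"
  proof -
  let ?w = "\<lambda>m k. (\<Sum>i=0..m. ln 2 ^ i / fact i * mzv ([-1] @ ones (m - i) @ [2] @ ones p @ [2] @ ones k))
    + ln 2 ^ Suc m / fact (Suc m) * mzv ([-2] @ ones p @ [2] @ ones k)"
  let ?b = "\<lambda>m. mzv ([-2] @ ones m)" and ?d = "\<lambda>m j. mzv ([-1] @ ones j @ [2] @ ones m)"
  have w: "has_value_m1 (shuffle_fps (ones p @ [2] @ ones j) (Suc i)) (?w i j)" for i j
    by (rule has_value_m1_shuffle_fps) (auto dest: in_set_replicate[THEN iffD1])
  have sum: "has_value_m1 (\<Sum>i=1..p. (-1) ^ i * height_one_fps m i * height_one_fps k (Suc (p - i)))
      (\<Sum>i=1..p. (-1) ^ i * ?d m (i - 1) * ?d k (p - i))"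
  proof (intro has_value_m1_sum has_value_m1_mult has_value_m1_minus_one_power has_value_m1_height_one_fps_Suc)
    fix i assume "i \<in> {1..p}"
    then show "has_value_m1 (height_one_fps m i) (?d m (i - 1))"
      using has_value_m1_height_one_fps_Suc[of m "i - 1"] by simp
  qed
  have L: "has_value_m1 ((-1) ^ (k + p) * shuffle_fps (ones p @ [2] @ ones k) (Suc m)
      + (-1) ^ (m + 1) * shuffle_fps (ones p @ [2] @ ones m) (Suc k))
    ((-1) ^ (k + p) * ?w m k + (-1) ^ (m + 1) * ?w k m)"
    by (intro has_value_m1_add has_value_m1_mult has_value_m1_minus_one_power w)
  have R: "has_value_m1 ((-1) ^ (m + k + p + 1) * (height_one_fps m 0 * height_one_fps k (Suc p))
      + (-1) ^ (m + k) * (height_one_fps k 0 * height_one_fps m (Suc p))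
      + (-1) ^ (m + k + p + 1) * (\<Sum>i=1..p. (-1) ^ i * height_one_fps m i * height_one_fps k (Suc (p - i))))
    ((-1) ^ (m + k + p + 1) * (?b m * ?d k p) + (-1) ^ (m + k) * (?b k * ?d m p)
      + (-1) ^ (m + k + p + 1) * (\<Sum>i=1..p. (-1) ^ i * ?d m (i - 1) * ?d k (p - i)))"
    by (intro has_value_m1_add has_value_m1_mult has_value_m1_minus_one_power
        has_value_m1_height_one_fps_0 has_value_m1_height_one_fps_Suc sum)
  \<comment> \<open>By \<open>shuffle_fps_identity\<close> both evaluations concern one series,
    whose value is unique.\<close>
  have eq: "(-1) ^ (k + p) * ?w m k + (-1) ^ (m + 1) * ?w k m
    = (-1) ^ (m + k + p + 1) * (?b m * ?d k p) + (-1) ^ (m + k) * (?b k * ?d m p)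
      + (-1) ^ (m + k + p + 1) * (\<Sum>i=1..p. (-1) ^ i * ?d m (i - 1) * ?d k (p - i))"
    using has_value_m1_unique[OF L[unfolded shuffle_fps_identity] R] .
  \<comment> \<open>Denominators are cleared with \<open>M\<close> as \<open>fact (m + 1)\<close>
    and \<open>K\<close> as \<open>fact (k + 1)\<close>; abstract reals keep this to pure
    algebra.\<close>
  have ident: "s1 * M * K * S1 + s2 * K * M * S2 + s1 * K * x * u + s2 * M * y * v
      = s3 * M * K * a * b + s4 * K * M * c * e + s3 * K * M * z"
    if "s1 * (S1 + x / M * u) + s2 * (S2 + y / K * v) = s3 * (a * b) + s4 * (c * e) + s3 * z"
      and "M \<noteq> 0" "K \<noteq> 0" for s1 s2 s3 s4 M K S1 S2 x y u v a b c e z :: real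
  proof -
    have "s1 * M * K * S1 + s2 * K * M * S2 + s1 * K * x * u + s2 * M * y * v
        = M * K * (s1 * (S1 + x / M * u) + s2 * (S2 + y / K * v))"
      using that(2,3) by (simp add: algebra_simps)
    then show ?thesis
      unfolding that(1) by (simp add: algebra_simps)
  qed
  show ?thesis
    by (rule ident) (use eq in \<open>simp_all only: Suc_eq_plus1 fact_nonzero not_False_eq_True\<close>)
qed

end
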